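(* Let $d \ge 1$ and let $\{A_k\}_{k=1}^\infty$ be a sequence of finite subsets of $\mathbb{R}^d$ satisfying $\# A_k \ge 2$ for each $k \ge 1$. For each $n\ge 1$ let $\nu_n = \delta_{A_1} * \delta_{A_2} * \cdots * \delta_{A_n}$. Suppose that $$\sum_{k=1}^{\infty} \max\{|a|^2 : a\in A_k\} < \infty,$$ and that the series $$\sum_{k=1}^{\infty} \frac{1}{\# A_k} \sum_{a \in A_k} a$$ converges in $\mathbb{R}^d$. Then the infinite convolution $\nu = \delta_{A_1} * \delta_{A_2} * \cdots * \delta_{A_k} * \cdots$ exists, i.e. the sequence $\{\nu_n\}$ converges weakly to a Borel probability measure on $\mathbb{R}^d$.
   Context: Notation: $\#$ denotes the cardinality of a set; $|a|$ is the Euclidean norm of $a\in\mathbb{R}^d$. For a finite nonempty set $A \subseteq \mathbb{R}^d$, $\delta_A = \frac{1}{\# A} \sum_{a \in A} \delta_a$ is the uniform discrete probability measure on $A$, where $\delta_a$ is the Dirac measure at $a$. The symbol $*$ denotes convolution of measures. A sequence of Borel probability measures $\mu_n$ on $\mathbb{R}^d$ converges weakly to a Borel probability measure $\mu$ if $\int f \, d\mu_n \to \int f \, d\mu$ for every bounded continuous function $f$ on $\mathbb{R}^d$. If $\{\nu_n\}$ converges weakly to a Borel probability measure, the weak limit is called the infinite convolution of $\{\delta_{A_k}\}$. Convergence of a series means convergence of its sequence of partial sums. *)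

theory Defs
  imports "HOL-Probability.Probability"
begin

definition borel_prob :: "'a::topological_space measure \<Rightarrow> bool" where
  "borel_prob M \<longleftrightarrow> sets M = sets borel \<and> prob_space M"

definition weakly_converges_to ::
    "(nat \<Rightarrow> 'a::topological_space measure) \<Rightarrow> 'a measure \<Rightarrow> bool" where
  "weakly_converges_to M N \<longleftrightarrow>
     (\<forall>n. borel_prob (M n)) \<and> borel_prob N \<and>
     (\<forall>f::'a \<Rightarrow> real. continuous_on UNIV f \<longrightarrow> bounded (range f) \<longrightarrow>
        (\<lambda>n. integral\<^sup>L (M n) f) \<longlonglongrightarrow> integral\<^sup>L N f)"

definition uniform_dirac :: "'a::topological_space set \<Rightarrow> 'a measure" where
  "uniform_dirac A =
     measure_of UNIV (sets borel)
       (\<lambda>B. (\<Sum>a\<in>A. emeasure (return borel a) B) / of_nat (card A))"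

text \<open>
  Sequences of measures are indexed from 1 (the value at 0 is ignored):
  the convolution of the first n terms is M 1 * ... * M n. The empty convolution is the
  Dirac measure at the origin, the neutral element of convolution.
\<close>

primrec conv_upto :: "(nat \<Rightarrow> 'a::ordered_euclidean_space measure) \<Rightarrow> nat \<Rightarrow> 'a measure" where
  "conv_upto M 0 = return borel 0"
| "conv_upto M (Suc n) = convolution (conv_upto M n) (M (Suc n))"

definition is_infinite_convolution ::
    "(nat \<Rightarrow> 'a::ordered_euclidean_space measure) \<Rightarrow> 'a measure \<Rightarrow> bool" where
  "is_infinite_convolution M N \<longleftrightarrow> weakly_converges_to (conv_upto M) N"

lemma sets_uniform_dirac [simp]: "sets (uniform_dirac A) = sets borel"
  and space_uniform_dirac [simp]: "space (uniform_dirac A) = UNIV"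
  using sets.sigma_sets_eq[of borel]
  by (auto simp: uniform_dirac_def sets_measure_of_conv space_measure_of_conv)

lemma emeasure_uniform_dirac:
  assumes "B \<in> sets borel"
  shows "emeasure (uniform_dirac A) B =
    (\<Sum>a\<in>A. emeasure (return borel a) B) / of_nat (card A)"
proof (rule emeasure_measure_of[OF uniform_dirac_def])
  let ?f = "\<lambda>B. (\<Sum>a\<in>A. emeasure (return borel a) B) / of_nat (card A)"
  show "positive (sets (uniform_dirac A)) ?f"
    by (simp add: positive_def)
  show "countably_additive (sets (uniform_dirac A)) ?f"
    unfolding countably_additive_def
  proof (intro allI impI)
    fix F :: "nat \<Rightarrow> 'a set"
    assume F: "range F \<subseteq> sets (uniform_dirac A)" "disjoint_family F"
    have "(\<Sum>i. ?f (F i)) = (\<Sum>i. \<Sum>a\<in>A. emeasure (return borel a) (F i)) / of_nat (card A)"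
      by simp
    also have "(\<Sum>i. \<Sum>a\<in>A. emeasure (return borel a) (F i)) =
        (\<Sum>a\<in>A. \<Sum>i. emeasure (return borel a) (F i))"
      by (intro suminf_sum) auto
    also have "\<dots> = (\<Sum>a\<in>A. emeasure (return borel a) (\<Union>i. F i))"
      using F by (intro sum.cong refl suminf_emeasure) auto
    finally show "(\<Sum>i. ?f (F i)) = ?f (\<Union>i. F i)" .
  qed
qed (use assms in auto)

lemma borel_prob_uniform_dirac:
  assumes "finite A" "A \<noteq> {}"
  shows "borel_prob (uniform_dirac A)"
proof -
  have "emeasure (uniform_dirac A) UNIV = of_nat (card A) / of_nat (card A)"
    by (subst emeasure_uniform_dirac) auto
  also have "\<dots> = 1"
    using assms by (intro ennreal_divide_self) (auto simp: ennreal_of_nat_eq_real_of_nat)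
  finally show ?thesis
    by (auto simp: borel_prob_def intro!: prob_spaceI)
qed

lemma convolution_return_0_left:
  assumes "borel_prob N"
  shows "convolution (return borel 0) N = N"
proof (rule measure_eqI)
  have N [measurable_cong]: "sets N = sets borel"
    using assms by (simp add: borel_prob_def)
  interpret P: prob_space N
    using assms by (simp add: borel_prob_def)
  interpret R: prob_space "return borel (0::'a)"
    by (rule prob_space_return) simp
  show "sets (convolution (return borel 0) N) = sets N"
    by (simp add: N)
  fix B assume "B \<in> sets (convolution (return borel 0) N)"
  then have B [measurable]: "B \<in> sets borel" by simp
  have "emeasure (convolution (return borel 0) N) B =
      (\<integral>\<^sup>+x. (\<integral>\<^sup>+y. indicator B (x + y) \<partial>N) \<partial>return borel 0)"
    by (intro convolution_emeasure' B N P.finite_measure_axioms R.finite_measure_axioms) simp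
  also have "\<dots> = (\<integral>\<^sup>+y. indicator B (0 + y) \<partial>N)"
    by (subst nn_integral_return) auto
  also have "\<dots> = emeasure N B"
    using B N by simp
  finally show "emeasure (convolution (return borel 0) N) B = emeasure N B" .
qed

lemma conv_upto_1:
  assumes "borel_prob (M 1)"
  shows "conv_upto M 1 = M 1"
  using convolution_return_0_left[OF assms] by simp

end

theory Submission
  imports Defs
begin

text \<open>
  On the product of the given measures the coordinates $X_k$ are independent, and the
  convolution of the first $n$ measures is the law of $X_1 + \ldots + X_n$. The centred
  variables are pairwise orthogonal in $L^2$ and have summable variances, so their partial sums
  are Cauchy in $L^2$, hence in $L^1$, and converge in probability; adding the convergent series
  of means, so do the sums of the $X_k$. Convergence in probability implies weak convergence of
  the laws.
\<close>

section \<open>Convergence in probability\<close>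

text \<open>The expectation of \<open>min 1 (norm (Z n x - S x))\<close> metrizes convergence in
  probability. As in the Riesz-Fischer theorem, a subsequence with rapidly shrinking L^1 gaps
  converges almost surely. The Cauchy property then carries convergence over to the whole sequence,
  the truncation at 1 providing a dominating constant.\<close>

lemma (in prob_space) L1_Cauchy_imp_tendsto_in_probability:
  fixes Z :: "nat \<Rightarrow> 'a \<Rightarrow> 'b::{banach, second_countable_topology}"
  assumes int [simp]: "\<And>n. integrable M (Z n)"
    and Cauchy: "\<And>e. e > 0 \<Longrightarrow> \<exists>N. \<forall>m\<ge>N. \<forall>n\<ge>N. expectation (\<lambda>x. norm (Z m x - Z n x)) < e"
  shows "\<exists>S \<in> borel_measurable M. (\<lambda>n. expectation (\<lambda>x. min 1 (norm (Z n x - S x)))) \<longlonglongrightarrow> 0"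
proof -
  have [measurable]: "Z n \<in> borel_measurable M" for n
    using int by (rule borel_measurable_integrable)
  define P where "P j N \<longleftrightarrow> (\<forall>m\<ge>N. \<forall>n\<ge>N. expectation (\<lambda>x. norm (Z m x - Z n x)) < (1/2)^j)" for j N
  \<comment> \<open>Picks indices so that consecutive terms of the subsequence are less than
    \<open>(1/2)^j\<close> apart in L^1; these bounds form a convergent geometric series.\<close>
  have "\<exists>r. \<forall>j. P j (r j) \<and> r j < r (Suc j)"
  proof (rule dependent_nat_choice)
    show "\<exists>N. P 0 N"
      using Cauchy[of 1] by (auto simp: P_def)
    show "\<exists>y. P (Suc n) y \<and> x < y" for x n
    proof -
      obtain N where "P (Suc n) N"
        using Cauchy[of "(1/2)^Suc n"] by (auto simp: P_def)
      then have "P (Suc n) (max N (Suc x)) \<and> x < max N (Suc x)"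
        by (auto simp: P_def)
      then show ?thesis ..
    qed
  qed
  then obtain r where r: "\<And>j. P j (r j)" "\<And>j. r j < r (Suc j)" by blast
  have mono: "strict_mono r"
    using r(2) by (simp add: strict_mono_Suc_iff)
  define D where "D j x = norm (Z (r (Suc j)) x - Z (r j) x)" for j x
  have [measurable]: "D j \<in> borel_measurable M" for j
    unfolding D_def by measurable
  have intD: "integrable M (D j)" for j
    unfolding D_def by simp
  have ED: "expectation (D j) \<le> (1/2)^j" for j
    using r(1)[of j] r(2)[of j] less_imp_le[OF r(2)[of j]] unfolding P_def D_def by (meson less_imp_le order_refl)
  \<comment> \<open>By monotone convergence the total length of the path j \<mapsto>
    \<open>Z (r j) x\<close> has finite expectation. Hence it is finite for almost every x, and the
    telescoping series converges absolutely.\<close>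
  have "(\<integral>\<^sup>+x. (\<Sum>j. ennreal (D j x)) \<partial>M) = (\<Sum>j. \<integral>\<^sup>+x. ennreal (D j x) \<partial>M)"
    by (intro nn_integral_suminf) simp
  also have "\<dots> = (\<Sum>j. ennreal (expectation (D j)))"
    by (intro suminf_cong nn_integral_eq_integral intD) (simp add: D_def)
  also have "\<dots> \<le> (\<Sum>j. ennreal ((1/2)^j))"
    by (intro suminf_le ennreal_leI ED) simp_all
  also have "\<dots> = ennreal (\<Sum>j. (1/2)^j)"
    by (intro suminf_ennreal2) (simp_all add: summable_geometric)
  also have "\<dots> < \<infinity>" by simp
  finally have "(\<integral>\<^sup>+x. (\<Sum>j. ennreal (D j x)) \<partial>M) \<noteq> \<infinity>" by simp
  then have "AE x in M. (\<Sum>j. ennreal (D j x)) \<noteq> \<infinity>"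
    by (intro nn_integral_noteq_infinite) simp_all
  then have conv: "AE x in M. (\<lambda>j. Z (r j) x) \<longlonglongrightarrow> lim (\<lambda>j. Z (r j) x)"
  proof eventually_elim
    case (elim x)
    then have "summable (\<lambda>j. D j x)"
      by (intro summable_suminf_not_top) (auto simp: D_def)
    then have "summable (\<lambda>j. Z (r (Suc j)) x - Z (r j) x)"
      unfolding D_def by (rule summable_norm_cancel)
    then have "convergent (\<lambda>n. \<Sum>j<n. Z (r (Suc j)) x - Z (r j) x)"
      by (simp add: summable_iff_convergent)
    then have "convergent (\<lambda>n. Z (r n) x - Z (r 0) x)"
      by (simp add: sum_lessThan_telescope[of "\<lambda>j. Z (r j) x"])
    then have "convergent (\<lambda>n. Z (r n) x)"
      using convergent_diff_const_right_iff by fastforce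
    then show ?case
      by (simp add: convergent_LIMSEQ_iff)
  qed
  \<comment> \<open>Where the subsequence diverges, \<open>lim\<close> returns some default value;
    this happens only on a null set.\<close>
  define S where "S x = lim (\<lambda>j. Z (r j) x)" for x
  have [measurable]: "S \<in> borel_measurable M"
    unfolding S_def by measurable
  have "(\<lambda>n. expectation (\<lambda>x. min 1 (norm (Z n x - S x)))) \<longlonglongrightarrow> 0"
  proof (rule LIMSEQ_I)
    fix e :: real assume "e > 0"
    then obtain N where N: "\<And>m n. m \<ge> N \<Longrightarrow> n \<ge> N \<Longrightarrow> expectation (\<lambda>x. norm (Z m x - Z n x)) < e/2"
      using Cauchy[of "e/2"] by auto
    show "\<exists>N. \<forall>n\<ge>N. norm (expectation (\<lambda>x. min 1 (norm (Z n x - S x))) - 0) < e"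
    proof (intro exI allI impI)
      fix n assume n: "n \<ge> N"
      \<comment> \<open>With n fixed, \<open>S\<close> is replaced by \<open>Z (r j)\<close> and j
        tends to infinity. A limit keeps only the weak inequality, hence the bound
        \<open>e/2\<close> instead of \<open>e\<close>.\<close>
      have "(\<lambda>j. expectation (\<lambda>x. min 1 (norm (Z n x - Z (r j) x))))
          \<longlonglongrightarrow> expectation (\<lambda>x. min 1 (norm (Z n x - S x)))"
      proof (rule integral_dominated_convergence[where w = "\<lambda>_. 1"])
        show "AE x in M. (\<lambda>j. min 1 (norm (Z n x - Z (r j) x))) \<longlonglongrightarrow> min 1 (norm (Z n x - S x))"
          using conv unfolding S_def by eventually_elim (intro tendsto_intros)
      qed auto
      moreover have "\<forall>\<^sub>F j in sequentially. expectation (\<lambda>x. min 1 (norm (Z n x - Z (r j) x))) \<le> e/2"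
        using eventually_ge_at_top[of N]
      proof eventually_elim
        case (elim j)
        then have "r j \<ge> N" using seq_suble[OF mono, of j] by simp
        have "expectation (\<lambda>x. min 1 (norm (Z n x - Z (r j) x))) \<le> expectation (\<lambda>x. norm (Z n x - Z (r j) x))"
          by (intro integral_mono[OF integrable_const_bound[where B=1]]) auto
        then show ?case using N[OF n \<open>r j \<ge> N\<close>] by simp
      qed
      ultimately have "expectation (\<lambda>x. min 1 (norm (Z n x - S x))) \<le> e/2"
        by (intro tendsto_upperbound) auto
      moreover have "expectation (\<lambda>x. min 1 (norm (Z n x - S x))) \<ge> 0"
        by (intro integral_nonneg_AE) auto
      ultimately show "norm (expectation (\<lambda>x. min 1 (norm (Z n x - S x))) - 0) < e"
        using \<open>e > 0\<close> by simp
    qed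
  qed
  then show ?thesis by (intro bexI[of _ S]) auto
qed

text \<open>Otherwise some subsequence of the expectations stays at least e away from the limit. It
  has a further subsequence along which \<open>X\<close> converges almost surely to
  \<open>S\<close>, and there continuity of \<open>f\<close> and dominated convergence give a
  contradiction.\<close>

lemma (in prob_space) tendsto_in_probability_imp_expectation:
  fixes X :: "nat \<Rightarrow> 'a \<Rightarrow> 'b::{real_normed_vector, second_countable_topology}" and f :: "'b \<Rightarrow> real"
  assumes [measurable]: "\<And>n. X n \<in> borel_measurable M" "S \<in> borel_measurable M"
    and lim: "(\<lambda>n. expectation (\<lambda>x. min 1 (norm (X n x - S x)))) \<longlonglongrightarrow> 0"
    and f: "continuous_on UNIV f" "bounded (range f)"
  shows "(\<lambda>n. expectation (\<lambda>x. f (X n x))) \<longlonglongrightarrow> expectation (\<lambda>x. f (S x))"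
proof (rule ccontr)
  have [measurable]: "f \<in> borel_measurable borel"
    using f(1) by (rule borel_measurable_continuous_onI)
  obtain B where B: "\<And>y. norm (f y) \<le> B"
    using f(2) by (auto simp: bounded_iff)
  let ?F = "\<lambda>n. expectation (\<lambda>x. f (X n x))"
  let ?L = "expectation (\<lambda>x. f (S x))"
  assume "\<not> ?F \<longlonglongrightarrow> ?L"
  then obtain e where e: "e > 0" "\<And>N. \<exists>n\<ge>N. \<not> dist (?F n) ?L < e"
    unfolding lim_sequentially by auto
  then have "infinite {n. \<not> dist (?F n) ?L < e}"
    unfolding infinite_nat_iff_unbounded_le by auto
  then obtain r :: "nat \<Rightarrow> nat" where r: "strict_mono r" "\<And>n. \<not> dist (?F (r n)) ?L < e"
    using infinite_enumerate[of "{n. \<not> dist (?F n) ?L < e}"] by auto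
  define u where "u n x = min 1 (norm (X (r n) x - S x))" for n x
  have "integrable M (u n)" for n
    unfolding u_def by (intro integrable_const_bound[where B=1]) auto
  moreover have "(\<lambda>n. \<integral>x. norm (u n x) \<partial>M) \<longlonglongrightarrow> 0"
    using LIMSEQ_subseq_LIMSEQ[OF lim r(1)] by (simp add: u_def o_def)
  ultimately obtain s where s: "strict_mono s" "AE x in M. (\<lambda>n. u (s n) x) \<longlonglongrightarrow> 0"
    using tendsto_L1_AE_subseq[of M u] by blast
  have "(\<lambda>n. ?F (r (s n))) \<longlonglongrightarrow> ?L"
  proof (rule integral_dominated_convergence[where w = "\<lambda>_. B"])
    show "AE x in M. (\<lambda>n. f (X (r (s n)) x)) \<longlonglongrightarrow> f (S x)"
      using s(2)
    proof eventually_elim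
      case (elim x)
      \<comment> \<open>Once the truncated distance is below 1 the truncation is inactive, so the
        distance itself tends to 0.\<close>
      have "\<forall>\<^sub>F n in sequentially. u (s n) x < 1"
        using elim by (rule order_tendstoD) simp
      then have "\<forall>\<^sub>F n in sequentially. u (s n) x = norm (X (r (s n)) x - S x)"
        by eventually_elim (auto simp: u_def min_def)
      with elim have "(\<lambda>n. norm (X (r (s n)) x - S x)) \<longlonglongrightarrow> 0"
        using tendsto_cong by fastforce
      then have "(\<lambda>n. X (r (s n)) x) \<longlonglongrightarrow> S x"
        by (simp add: tendsto_norm_zero_iff LIM_zero_iff)
      then show ?case
        using f(1) by (auto intro: continuous_on_tendsto_compose)
    qed
  qed (use B in auto)
  then obtain n where "dist (?F (r (s n))) ?L < e"
    using e(1) unfolding lim_sequentially by blast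
  with r(2) show False by blast
qed

section \<open>Orthogonality and series of centred independent vectors\<close>

text \<open>Pythagoras in L^2: for independent centred vectors the expected inner product of two
  different terms vanishes, so only the diagonal of the expanded square remains.\<close>

lemma (in prob_space) expectation_norm_sum_square:
  fixes Y :: "'i \<Rightarrow> 'a \<Rightarrow> 'b::euclidean_space"
  assumes "finite I" and indep: "indep_vars (\<lambda>_. borel) Y I"
    and sq: "\<And>i. i \<in> I \<Longrightarrow> integrable M (\<lambda>x. (norm (Y i x))\<^sup>2)"
    and int: "\<And>i. i \<in> I \<Longrightarrow> integrable M (Y i)"
    and mean: "\<And>i. i \<in> I \<Longrightarrow> expectation (Y i) = 0"
  shows "integrable M (\<lambda>x. (norm (\<Sum>i\<in>I. Y i x))\<^sup>2)"
    and "expectation (\<lambda>x. (norm (\<Sum>i\<in>I. Y i x))\<^sup>2) = (\<Sum>i\<in>I. expectation (\<lambda>x. (norm (Y i x))\<^sup>2))"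
proof -
  have cross: "integrable M (\<lambda>x. Y i x \<bullet> Y j x) \<and> expectation (\<lambda>x. Y i x \<bullet> Y j x) = 0"
    if ij: "i \<in> I" "j \<in> I" "i \<noteq> j" for i j
  proof -
    \<comment> \<open>The product rule for expectations concerns scalar variables, so the inner
      product is treated coordinatewise: for each direction b the two projections are independent
      and have mean 0.\<close>
    have b: "integrable M (\<lambda>x. (Y i x \<bullet> b) * (Y j x \<bullet> b)) \<and> expectation (\<lambda>x. (Y i x \<bullet> b) * (Y j x \<bullet> b)) = 0" for b
    proof -
      have "indep_vars (\<lambda>_. borel) (\<lambda>k x. Y k x \<bullet> b) {i, j}"
        by (rule indep_vars_compose2[OF indep_vars_subset[OF indep]]) (use ij in auto)
      moreover have "integrable M (\<lambda>x. Y k x \<bullet> b)" if "k \<in> {i, j}" for k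
        using that int ij by auto
      ultimately show ?thesis
        using indep_vars_lebesgue_integral[of "{i, j}" "\<lambda>k x. Y k x \<bullet> b"]
          indep_vars_integrable[of "{i, j}" "\<lambda>k x. Y k x \<bullet> b"] ij int mean
        by simp
    qed
    show ?thesis
      using b by (subst (1 2) euclidean_inner) (simp add: Bochner_Integration.integral_sum)
  qed
  have expand: "(norm (\<Sum>i\<in>I. Y i x))\<^sup>2 = (\<Sum>i\<in>I. \<Sum>j\<in>I. Y i x \<bullet> Y j x)" for x
    by (simp add: power2_norm_eq_inner inner_sum_left inner_sum_right inner_commute)
  have pair: "integrable M (\<lambda>x. Y i x \<bullet> Y j x)" if "i \<in> I" "j \<in> I" for i j
    using cross[of i j] sq[of i] that by (cases "i = j") (auto simp: power2_norm_eq_inner)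
  show "integrable M (\<lambda>x. (norm (\<Sum>i\<in>I. Y i x))\<^sup>2)"
    unfolding expand using pair by auto
  have "expectation (\<lambda>x. (norm (\<Sum>i\<in>I. Y i x))\<^sup>2) = (\<Sum>i\<in>I. \<Sum>j\<in>I. expectation (\<lambda>x. Y i x \<bullet> Y j x))"
    unfolding expand using pair by (simp add: Bochner_Integration.integral_sum)
  also have "\<dots> = (\<Sum>i\<in>I. \<Sum>j\<in>I. if i = j then expectation (\<lambda>x. (norm (Y i x))\<^sup>2) else 0)"
    using cross by (intro sum.cong) (auto simp: power2_norm_eq_inner)
  also have "\<dots> = (\<Sum>i\<in>I. expectation (\<lambda>x. (norm (Y i x))\<^sup>2))"
    using \<open>finite I\<close> by simp
  finally show "expectation (\<lambda>x. (norm (\<Sum>i\<in>I. Y i x))\<^sup>2) = (\<Sum>i\<in>I. expectation (\<lambda>x. (norm (Y i x))\<^sup>2))" .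
qed

text \<open>The difference of the two sides is the variance of \<open>norm (Z x)\<close>.\<close>

lemma (in prob_space) square_expectation_norm_le:
  fixes Z :: "'a \<Rightarrow> 'b::{banach, second_countable_topology}"
  assumes "integrable M Z" "integrable M (\<lambda>x. (norm (Z x))\<^sup>2)"
  shows "(expectation (\<lambda>x. norm (Z x)))\<^sup>2 \<le> expectation (\<lambda>x. (norm (Z x))\<^sup>2)"
  using variance_eq[of "\<lambda>x. norm (Z x)"] variance_positive[of "\<lambda>x. norm (Z x)"] assms by simp

lemma (in prob_space) centered_indep_series_tendsto_in_probability:
  fixes Y :: "nat \<Rightarrow> 'a \<Rightarrow> 'b::euclidean_space"
  assumes indep: "indep_vars (\<lambda>_. borel) Y UNIV"
    and sq: "\<And>i. integrable M (\<lambda>x. (norm (Y i x))\<^sup>2)"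
    and int: "\<And>i. integrable M (Y i)"
    and mean: "\<And>i. expectation (Y i) = 0"
    and summable: "summable (\<lambda>i. expectation (\<lambda>x. (norm (Y i x))\<^sup>2))"
  shows "\<exists>S \<in> borel_measurable M.
    (\<lambda>n. expectation (\<lambda>x. min 1 (norm ((\<Sum>i<n. Y i x) - S x)))) \<longlonglongrightarrow> 0"
proof (rule L1_Cauchy_imp_tendsto_in_probability)
  show "integrable M (\<lambda>x. \<Sum>i<n. Y i x)" for n
    using int by simp
  fix e :: real assume e: "e > 0"
  let ?v = "\<lambda>i. expectation (\<lambda>x. (norm (Y i x))\<^sup>2)"
  let ?d = "\<lambda>m n. expectation (\<lambda>x. norm ((\<Sum>i<m. Y i x) - (\<Sum>i<n. Y i x)))"
  \<comment> \<open>The threshold is the square of \<open>e\<close> because a block of variances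
    bounds the square of the L^1 distance between two partial sums.\<close>
  obtain N where N: "\<And>m n. m \<ge> N \<Longrightarrow> norm (sum ?v {m..<n}) < e\<^sup>2"
    using summable e unfolding summable_Cauchy by (meson zero_less_power)
  have less: "?d m n < e" if "N \<le> n" "n \<le> m" for m n
  proof -
    have diff: "(\<Sum>i<m. Y i x) - (\<Sum>i<n. Y i x) = (\<Sum>i\<in>{n..<m}. Y i x)" for x
      using sum_diff_nat_ivl[of 0 n m "\<lambda>i. Y i x"] that by (simp add: atLeast0LessThan)
    have ind: "indep_vars (\<lambda>_. borel) Y {n..<m}"
      using indep by (rule indep_vars_subset) simp
    have "(?d m n)\<^sup>2 \<le> sum ?v {n..<m}"
      unfolding diff
      using square_expectation_norm_le[of "\<lambda>x. \<Sum>i\<in>{n..<m}. Y i x"] int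
        expectation_norm_sum_square[OF _ ind sq int mean] by simp
    also have "\<dots> < e\<^sup>2" using N[of n m] that by simp
    finally show ?thesis using e power_less_imp_less_base by fastforce
  qed
  have "?d m n < e" if "m \<ge> N" "n \<ge> N" for m n
  proof (cases "n \<le> m")
    case False
    then show ?thesis using less[of m n] that by (simp add: norm_minus_commute)
  qed (use less that in simp)
  then show "\<exists>N. \<forall>m\<ge>N. \<forall>n\<ge>N. ?d m n < e" by blast
qed

section \<open>Product spaces and convolutions\<close>

text \<open>Independence means that the joint law is the product of the marginals. Here the joint
  map restricts a point to \<open>I\<close>, which is the identity on the product space, and the
  i-th marginal is \<open>N i\<close>.\<close>

lemma indep_vars_PiM_coordinates:
  assumes "\<And>i. i \<in> I \<Longrightarrow> prob_space (N i)" "I \<noteq> {}"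
  shows "prob_space.indep_vars (PiM I N) N (\<lambda>i \<omega>. \<omega> i) I"
proof -
  interpret prob_space "PiM I N"
    by (rule prob_space_PiM) (rule assms)
  have "distr (PiM I N) (PiM I N) (\<lambda>x. \<lambda>i\<in>I. x i) = distr (PiM I N) (PiM I N) (\<lambda>x. x)"
    by (rule distr_cong) (auto simp: space_PiM)
  also have "\<dots> = PiM I (\<lambda>i. distr (PiM I N) (N i) (\<lambda>\<omega>. \<omega> i))"
    by (auto simp: distr_id2 intro!: PiM_cong distr_PiM_component[symmetric] assms)
  finally show ?thesis
    by (subst indep_vars_iff_distr_eq_PiM') (use assms in auto)
qed

text \<open>The variables are numbered from 0 and the measures from 1, hence
  \<open>N (Suc i)\<close>. The empty sum has the Dirac law at 0, matching the empty
  convolution.\<close>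

lemma (in prob_space) distr_sum_eq_conv_upto:
  fixes X :: "nat \<Rightarrow> 'a \<Rightarrow> 'b::ordered_euclidean_space"
  assumes indep: "indep_vars (\<lambda>_. borel) X UNIV"
    and distr: "\<And>i. distr M borel (X i) = N (Suc i)"
  shows "distr M borel (\<lambda>x. \<Sum>i<n. X i x) = conv_upto N n"
proof (induction n)
  case 0
  show ?case by (simp add: distr_const)
next
  case (Suc n)
  have [measurable]: "X i \<in> borel_measurable M" for i
    using indep by (auto simp: indep_vars_def)
  \<comment> \<open>The sum of the first n variables and the next variable are functions of disjoint
    blocks of an independent family, hence independent of each other.\<close>
  have "indep_var
      borel ((\<lambda>f. \<Sum>i<n. f i) \<circ> (\<lambda>\<omega>. restrict (\<lambda>i. X i \<omega>) {..<n}))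
      borel ((\<lambda>f. f n) \<circ> (\<lambda>\<omega>. restrict (\<lambda>i. X i \<omega>) {n}))"
    by (intro indep_var_compose[OF indep_var_restrict[OF indep]]) auto
  moreover have "(\<lambda>f. \<Sum>i<n. f i) \<circ> (\<lambda>\<omega>. restrict (\<lambda>i. X i \<omega>) {..<n}) = (\<lambda>x. \<Sum>i<n. X i x)"
    by auto
  moreover have "(\<lambda>f. f n) \<circ> (\<lambda>\<omega>. restrict (\<lambda>i. X i \<omega>) {n}) = X n"
    by auto
  ultimately have "indep_var borel (\<lambda>x. \<Sum>i<n. X i x) borel (X n)" by simp
  then show ?case
    using sum_indep_random_variable[of "\<lambda>x. \<Sum>i<n. X i x" "X n"] Suc distr by simp
qed

section \<open>Existence for general laws with summable second moments\<close>

text \<open>Discreteness of the measures enters the argument only through their means and second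
  moments, so existence is proved for arbitrary Borel laws.\<close>

theorem infinite_convolution_exists:
  fixes N :: "nat \<Rightarrow> 'a::ordered_euclidean_space measure"
  assumes N: "\<And>k. k \<ge> 1 \<Longrightarrow> borel_prob (N k)"
    and sq: "\<And>k. k \<ge> 1 \<Longrightarrow> integrable (N k) (\<lambda>a. (norm a)\<^sup>2)"
    and summable_sq: "summable (\<lambda>k. \<integral>a. (norm a)\<^sup>2 \<partial>N (Suc k))"
    and summable_mean: "summable (\<lambda>k. \<integral>a. a \<partial>N (Suc k))"
  shows "\<exists>\<nu>. is_infinite_convolution N \<nu>"
proof -
  define P where "P = PiM UNIV (\<lambda>k. N (Suc k))"
  have prob: "prob_space (N (Suc k))" and sets [measurable_cong]: "sets (N (Suc k)) = sets borel" for k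
    using N by (auto simp: borel_prob_def)
  interpret prob_space P
    unfolding P_def by (rule prob_space_PiM) (rule prob)
  define X :: "nat \<Rightarrow> (nat \<Rightarrow> 'a) \<Rightarrow> 'a" where "X k \<omega> = \<omega> k" for k \<omega>
  have "indep_vars (\<lambda>k. N (Suc k)) X UNIV"
    unfolding P_def X_def by (rule indep_vars_PiM_coordinates) (auto intro: prob)
  \<comment> \<open>Composition with the identity changes the target of each coordinate from
    \<open>N (Suc k)\<close> to \<open>borel\<close>, which has the same measurable sets.\<close>
  then have indep: "indep_vars (\<lambda>_. borel) X UNIV"
    using indep_vars_compose2[of "\<lambda>k. N (Suc k)" X UNIV "\<lambda>_ x. x" "\<lambda>_. borel"] by simp
  then have [measurable]: "X k \<in> borel_measurable P" for k
    by (auto simp: indep_vars_def)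
  have distr: "distr P borel (X k) = N (Suc k)" for k
    using distr_PiM_component[of UNIV "\<lambda>k. N (Suc k)" k] prob
    by (simp add: P_def X_def [abs_def] sets cong: distr_cong)
  have sqX: "integrable P (\<lambda>x. (norm (X k x))\<^sup>2)"
    and EsqX: "expectation (\<lambda>x. (norm (X k x))\<^sup>2) = (\<integral>a. (norm a)\<^sup>2 \<partial>N (Suc k))"
    and meanX: "expectation (X k) = (\<integral>a. a \<partial>N (Suc k))" for k
    using sq[of "Suc k"] unfolding distr[symmetric]
    by (auto simp: integrable_distr_eq integral_distr)
  have intX: "integrable P (X k)" for k
    using square_integrable_imp_integrable[of "\<lambda>x. norm (X k x)"] sqX[of k]
    by (simp add: integrable_norm_iff)
  define m where "m k = expectation (X k)" for k
  define Y where "Y k x = X k x - m k" for k x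
  have Y_sq: "(norm (Y k x))\<^sup>2 = (norm (X k x))\<^sup>2 - 2 * (X k x \<bullet> m k) + (norm (m k))\<^sup>2" for k x
    by (simp add: Y_def power2_norm_eq_inner inner_diff_left inner_diff_right inner_commute)
  \<comment> \<open>Centring can only lower the second moment, so the variances are summable by
    comparison with the given second moments.\<close>
  have EY: "expectation (\<lambda>x. (norm (Y k x))\<^sup>2) = expectation (\<lambda>x. (norm (X k x))\<^sup>2) - (norm (m k))\<^sup>2" for k
    unfolding Y_sq using sqX[of k] intX[of k]
    by (simp add: prob_space power2_norm_eq_inner m_def)
  have "\<exists>S \<in> borel_measurable P.
    (\<lambda>n. expectation (\<lambda>x. min 1 (norm ((\<Sum>i<n. Y i x) - S x)))) \<longlonglongrightarrow> 0"
  proof (rule centered_indep_series_tendsto_in_probability)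
    show "indep_vars (\<lambda>_. borel) Y UNIV"
      unfolding Y_def using indep by (rule indep_vars_compose2) auto
    show "integrable P (\<lambda>x. (norm (Y k x))\<^sup>2)" for k
      unfolding Y_sq using sqX[of k] intX[of k] by simp
    show "integrable P (Y k)" "expectation (Y k) = 0" for k
      unfolding Y_def using intX[of k] by (simp_all add: prob_space m_def)
    show "summable (\<lambda>k. expectation (\<lambda>x. (norm (Y k x))\<^sup>2))"
    proof (rule summable_comparison_test')
      show "summable (\<lambda>k. expectation (\<lambda>x. (norm (X k x))\<^sup>2))"
        using summable_sq by (simp add: EsqX)
      show "norm (expectation (\<lambda>x. (norm (Y k x))\<^sup>2)) \<le> expectation (\<lambda>x. (norm (X k x))\<^sup>2)" for k
      proof -
        have "0 \<le> expectation (\<lambda>x. (norm (Y k x))\<^sup>2)"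
          by (rule Bochner_Integration.integral_nonneg) simp
        with EY[of k] show ?thesis
          using zero_le_power2[of "norm (m k)"] unfolding real_norm_def by linarith
      qed
    qed
  qed
  then obtain S where S [measurable]: "S \<in> borel_measurable P"
    and lim: "(\<lambda>n. expectation (\<lambda>x. min 1 (norm ((\<Sum>i<n. Y i x) - S x)))) \<longlonglongrightarrow> 0" by blast
  define \<mu> where "\<mu> = (\<Sum>k. m k)"
  have \<mu>: "(\<lambda>n. \<Sum>i<n. m i) \<longlonglongrightarrow> \<mu>"
    using summable_mean unfolding \<mu>_def m_def meanX by (rule summable_LIMSEQ)
  \<comment> \<open>The error splits into the random error of the centred sums and the deterministic
    error of the means; min 1 (a + b) is at most min 1 a + b for nonnegative b.\<close>
  have lim': "(\<lambda>n. expectation (\<lambda>x. min 1 (norm ((\<Sum>i<n. X i x) - (S x + \<mu>))))) \<longlonglongrightarrow> 0"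
  proof (rule tendsto_sandwich)
    have [measurable]: "Y i \<in> borel_measurable P" for i
      unfolding Y_def by measurable
    show "\<forall>\<^sub>F n in sequentially. 0 \<le> expectation (\<lambda>x. min 1 (norm ((\<Sum>i<n. X i x) - (S x + \<mu>))))"
      by (intro always_eventually allI integral_nonneg_AE) auto
    show "\<forall>\<^sub>F n in sequentially. expectation (\<lambda>x. min 1 (norm ((\<Sum>i<n. X i x) - (S x + \<mu>))))
      \<le> expectation (\<lambda>x. min 1 (norm ((\<Sum>i<n. Y i x) - S x))) + norm ((\<Sum>i<n. m i) - \<mu>)"
    proof (intro always_eventually allI)
      fix n
      have int1: "integrable P (\<lambda>x. min 1 (norm ((\<Sum>i<n. Y i x) - S x)))"
        by (intro integrable_const_bound[where B=1]) auto
      have le: "min 1 (norm ((\<Sum>i<n. X i x) - (S x + \<mu>)))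
          \<le> min 1 (norm ((\<Sum>i<n. Y i x) - S x)) + norm ((\<Sum>i<n. m i) - \<mu>)" for x
      proof -
        have "(\<Sum>i<n. X i x) - (S x + \<mu>) = ((\<Sum>i<n. Y i x) - S x) + ((\<Sum>i<n. m i) - \<mu>)"
          by (simp add: Y_def sum_subtractf algebra_simps)
        then have "norm ((\<Sum>i<n. X i x) - (S x + \<mu>)) \<le> norm ((\<Sum>i<n. Y i x) - S x) + norm ((\<Sum>i<n. m i) - \<mu>)"
          by (metis norm_triangle_ineq)
        then show ?thesis
          using norm_ge_zero[of "(\<Sum>i<n. m i) - \<mu>"] by linarith
      qed
      have "expectation (\<lambda>x. min 1 (norm ((\<Sum>i<n. X i x) - (S x + \<mu>))))
        \<le> expectation (\<lambda>x. min 1 (norm ((\<Sum>i<n. Y i x) - S x)) + norm ((\<Sum>i<n. m i) - \<mu>))"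
        by (intro integral_mono le Bochner_Integration.integrable_add int1 integrable_const
            integrable_const_bound[where B=1]) auto
      also have "\<dots> = expectation (\<lambda>x. min 1 (norm ((\<Sum>i<n. Y i x) - S x))) + norm ((\<Sum>i<n. m i) - \<mu>)"
        using int1 by (simp add: prob_space)
      finally show "expectation (\<lambda>x. min 1 (norm ((\<Sum>i<n. X i x) - (S x + \<mu>)))) \<le> \<dots>" .
    qed
    have "(\<lambda>n. norm ((\<Sum>i<n. m i) - \<mu>)) \<longlonglongrightarrow> 0"
      using \<mu> by (simp add: tendsto_norm_zero_iff LIM_zero_iff)
    then show "(\<lambda>n. expectation (\<lambda>x. min 1 (norm ((\<Sum>i<n. Y i x) - S x))) + norm ((\<Sum>i<n. m i) - \<mu>)) \<longlonglongrightarrow> 0"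
      using tendsto_add[OF lim] by fastforce
  qed simp
  have conv: "conv_upto N n = distr P borel (\<lambda>x. \<Sum>i<n. X i x)" for n
    using distr_sum_eq_conv_upto[OF indep distr] by simp
  have "weakly_converges_to (conv_upto N) (distr P borel (\<lambda>x. S x + \<mu>))"
    unfolding weakly_converges_to_def
  proof (intro conjI allI impI)
    show "borel_prob (conv_upto N n)" for n
      unfolding conv borel_prob_def by (auto intro!: prob_space_distr)
    show "borel_prob (distr P borel (\<lambda>x. S x + \<mu>))"
      unfolding borel_prob_def by (auto intro!: prob_space_distr)
    fix f :: "'a \<Rightarrow> real" assume f: "continuous_on UNIV f" "bounded (range f)"
    then have [measurable]: "f \<in> borel_measurable borel"
      by (intro borel_measurable_continuous_onI)
    show "(\<lambda>n. integral\<^sup>L (conv_upto N n) f) \<longlonglongrightarrow> integral\<^sup>L (distr P borel (\<lambda>x. S x + \<mu>)) f"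
      unfolding conv
      using tendsto_in_probability_imp_expectation[OF _ _ lim' f] by (simp add: integral_distr)
  qed
  then show ?thesis
    unfolding is_infinite_convolution_def by blast
qed

section \<open>Uniform discrete measures\<close>

text \<open>Makes integrals against \<open>uniform_dirac A\<close> computable as finite sums. Both
  measures give a Borel set B the mass card (A \<inter> B) / card A.\<close>

lemma uniform_dirac_eq_distr_pmf_of_set:
  assumes "finite A" "A \<noteq> {}"
  shows "uniform_dirac A = distr (measure_pmf (pmf_of_set A)) borel (\<lambda>x. x)"
proof (rule measure_eqI)
  fix B assume "B \<in> sets (uniform_dirac A)"
  then have B: "B \<in> sets borel" by simp
  have "(\<Sum>a\<in>A. emeasure (return borel a) B) = of_nat (card (A \<inter> B))"
    using B assms by (simp add: indicator_def sum.If_cases Int_def)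
  then show "emeasure (uniform_dirac A) B = emeasure (distr (measure_pmf (pmf_of_set A)) borel (\<lambda>x. x)) B"
    using B assms by (simp add: emeasure_uniform_dirac emeasure_distr emeasure_pmf_of_set
        divide_ennreal[symmetric] ennreal_of_nat_eq_real_of_nat card_gt_0_iff)
qed simp

lemma
  fixes f :: "'a::topological_space \<Rightarrow> 'b::{banach, second_countable_topology}"
  assumes "finite A" "A \<noteq> {}" and [measurable]: "f \<in> borel_measurable borel"
  shows integrable_uniform_dirac: "integrable (uniform_dirac A) f"
    and integral_uniform_dirac: "integral\<^sup>L (uniform_dirac A) f = (1 / real (card A)) *\<^sub>R (\<Sum>a\<in>A. f a)"
proof -
  show "integrable (uniform_dirac A) f"
    using assms by (simp add: uniform_dirac_eq_distr_pmf_of_set integrable_distr_eq integrable_measure_pmf_finite)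
  show "integral\<^sup>L (uniform_dirac A) f = (1 / real (card A)) *\<^sub>R (\<Sum>a\<in>A. f a)"
    using assms(1,2)
    by (simp add: uniform_dirac_eq_distr_pmf_of_set integral_distr)
       (subst integral_measure_pmf[of A]; simp add: scaleR_right.sum divide_inverse)
qed

theorem theorem1p3:
  fixes A :: "nat \<Rightarrow> (real ^ 'n) set"
  assumes "\<And>k. k \<ge> 1 \<Longrightarrow> finite (A k)"
    and "\<And>k. k \<ge> 1 \<Longrightarrow> card (A k) \<ge> 2"
    and "summable (\<lambda>k. Max ((\<lambda>a. (norm a)\<^sup>2) ` A (Suc k)))"
    and "summable (\<lambda>k. (1 / real (card (A (Suc k)))) *\<^sub>R (\<Sum>a\<in>A (Suc k). a))"
  shows "\<exists>\<nu>. is_infinite_convolution (\<lambda>k. uniform_dirac (A k)) \<nu>"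
proof (rule infinite_convolution_exists)
  have A: "finite (A k)" "A k \<noteq> {}" "card (A k) > 0" if "k \<ge> 1" for k
    using assms(1,2)[OF that] by auto
  show "borel_prob (uniform_dirac (A k))" if "k \<ge> 1" for k
    using A[OF that] by (intro borel_prob_uniform_dirac)
  show "integrable (uniform_dirac (A k)) (\<lambda>a. (norm a)\<^sup>2)" if "k \<ge> 1" for k
    using A[OF that] by (intro integrable_uniform_dirac) auto
  show "summable (\<lambda>k. \<integral>a. a \<partial>uniform_dirac (A (Suc k)))"
    using assms(4) A by (simp add: integral_uniform_dirac)
  show "summable (\<lambda>k. \<integral>a. (norm a)\<^sup>2 \<partial>uniform_dirac (A (Suc k)))"
  \<comment> \<open>The second moment is an average of squared norms over \<open>A (Suc k)\<close>,
    hence at most their maximum.\<close>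
  proof (rule summable_comparison_test'[OF assms(3)])
    fix k
    let ?M = "Max ((\<lambda>a. (norm a)\<^sup>2) ` A (Suc k))"
    have "(\<Sum>a\<in>A (Suc k). (norm a)\<^sup>2) \<le> (\<Sum>a\<in>A (Suc k). ?M)"
      using A[of "Suc k"] by (intro sum_mono Max_ge) auto
    then have "(\<Sum>a\<in>A (Suc k). (norm a)\<^sup>2) / card (A (Suc k)) \<le> ?M"
      using A(3)[of "Suc k"] by (simp add: divide_le_eq mult.commute)
    then show "norm (\<integral>a. (norm a)\<^sup>2 \<partial>uniform_dirac (A (Suc k))) \<le> ?M"
      using A[of "Suc k"] by (simp add: integral_uniform_dirac sum_nonneg)
  qed
qed

end
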